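(* Let $Q$ be a prime power and let $m \ge 3$ be an integer. There exists a cheating strategy for Alice in the $m$-round $\mathbb{F}_Q$ bit commitment protocol whose cheating probability is at least $$1 - \frac{1}{2}\left(\left(1-\frac{1}{Q}\right)\bigl(1-\omega(\mathrm{CHSH}_Q)\bigr)\right)^{\lfloor \frac{m-1}{3}\rfloor}.$$ Equivalently, Alice's optimal cheating probability $g_m$ is at least this quantity.
   Context: $\mathbb{F}_Q$ is the finite field with $Q$ elements. The game $\mathrm{CHSH}_Q$: two non-communicating players receive independent uniform inputs $x,y\in\mathbb{F}_Q$ and output $a,b\in\mathbb{F}_Q$ respectively; they win iff $a+b=x\cdot y$. Its classical value is $\omega(\mathrm{CHSH}_Q)=\max_{s_1,s_2:\mathbb{F}_Q\to\mathbb{F}_Q}\Pr_{x,y}[s_1(x)+s_2(y)=xy]$. Cheating Alice in the $m$-round $\mathbb{F}_Q$ protocol $\mathcal{P}_m$ ($m\ge 2$): $d\in\{0,1\}$ (the bit to be revealed, viewed as an element of $\mathbb{F}_Q$) is uniform, $x_1,\dots,x_{m-1}\in\mathbb{F}_Q$ (Bob's messages in rounds $1,\dots,m-1$) are uniform, and all are independent. The agents of Alice answer alternately, and the agent answering round $i$ knows neither the message of round $i-1$ nor, in round 1, the bit $d$. Thus a cheating strategy is a tuple of functions $S=(s_1,\dots,s_m)$ with values in $\mathbb{F}_Q$, giving outputs $y_1=s_1(x_1)$, $y_i=s_i(d,x_1,\dots,x_{i-2},x_i)$ for $2\le i\le m-1$, and $y_m=s_m(d,x_1,\dots,x_{m-2})$.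 Set $\alpha_0:=d$ and $\alpha_i:=y_i-x_i\alpha_{i-1}$ for $1\le i\le m-1$. Alice succeeds iff $y_m=\alpha_{m-1}$. The cheating probability of $S$ is $g_m(S):=\Pr_{d,x_1,\dots,x_{m-1}}[y_m=\alpha_{m-1}]$, and $g_m:=\max_S g_m(S)$. *)

theory Defs
  imports "HOL-Probability.Probability"
begin

text \<open>
  The field with \<open>Q\<close> elements is a type \<open>'a::{finite,field}\<close> with \<open>CARD('a) = Q\<close>.
\<close>

definition CHSH_win_prob :: "('a::{finite,field} \<Rightarrow> 'a) \<Rightarrow> ('a \<Rightarrow> 'a) \<Rightarrow> real" where
  "CHSH_win_prob s1 s2 =
     measure_pmf.prob (pmf_of_set UNIV) {(x, y). s1 x + s2 y = x * y}"

definition CHSH_value :: "'a::{finite,field} itself \<Rightarrow> real" where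
  "CHSH_value _ = Max {CHSH_win_prob s1 s2 | s1 s2 :: 'a \<Rightarrow> 'a. True}"

text \<open>
  What each agent may know is enforced by the argument types: the answer in round 1 depends on
  \<open>x\<^sub>1\<close> only, the answer in round \<open>i\<close> (for \<open>2 \<le> i \<le> m - 1\<close>) on \<open>d\<close>, on the list
  \<open>[x\<^sub>1, \<dots>, x\<^sub>i\<^sub>-\<^sub>2]\<close> and on \<open>x\<^sub>i\<close>, the answer in round \<open>m\<close> on \<open>d\<close> and \<open>[x\<^sub>1, \<dots>, x\<^sub>m\<^sub>-\<^sub>2]\<close>.
  The values of \<open>mid_answer\<close> at indices outside \<open>{2..m - 1}\<close> are never used.
\<close>

record 'a strategy =
  first_answer :: "'a \<Rightarrow> 'a"
  mid_answer :: "nat \<Rightarrow> bool \<Rightarrow> 'a list \<Rightarrow> 'a \<Rightarrow> 'a"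
  last_answer :: "bool \<Rightarrow> 'a list \<Rightarrow> 'a"

text \<open>
  Bob's messages are a function \<open>x\<close> on \<open>{1..m - 1}\<close>, and \<open>map x [1..<k]\<close> is the list
  \<open>[x\<^sub>1, \<dots>, x\<^sub>k\<^sub>-\<^sub>1]\<close>.
\<close>

definition answer :: "nat \<Rightarrow> 'a strategy \<Rightarrow> bool \<Rightarrow> (nat \<Rightarrow> 'a) \<Rightarrow> nat \<Rightarrow> 'a" where
  "answer m S d x i =
     (if i = 1 then first_answer S (x 1)
      else if i = m then last_answer S d (map x [1..<m - 1])
      else mid_answer S i d (map x [1..<i - 1]) (x i))"

primrec \<alpha> :: "bool \<Rightarrow> (nat \<Rightarrow> 'a::field) \<Rightarrow> (nat \<Rightarrow> 'a) \<Rightarrow> nat \<Rightarrow> 'a" where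
  "\<alpha> d x y 0 = of_bool d"
| "\<alpha> d x y (Suc i) = y (Suc i) - x (Suc i) * \<alpha> d x y i"

definition success :: "nat \<Rightarrow> 'a::field strategy \<Rightarrow> bool \<Rightarrow> (nat \<Rightarrow> 'a) \<Rightarrow> bool" where
  "success m S d x \<longleftrightarrow> answer m S d x m = \<alpha> d x (answer m S d x) (m - 1)"

definition cheating_prob :: "nat \<Rightarrow> 'a::{finite,field} strategy \<Rightarrow> real" where
  "cheating_prob m S =
     measure_pmf.prob (pmf_of_set (UNIV \<times> ({1..m - 1} \<rightarrow>\<^sub>E UNIV))) {(d, x). success m S d x}"

definition optimal_cheating_prob :: "'a::{finite,field} itself \<Rightarrow> nat \<Rightarrow> real" where
  "optimal_cheating_prob _ m = Max (range (cheating_prob m :: 'a strategy \<Rightarrow> real))"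

text \<open>
  Both maxima are over finite nonempty sets of values, so they are attained.
\<close>

lemma finite_range_prob_pmf_of_set:
  assumes "finite A" "A \<noteq> {}"
  shows "finite (range (measure_pmf.prob (pmf_of_set A)))"
proof (rule finite_subset)
  show "range (measure_pmf.prob (pmf_of_set A)) \<subseteq> (\<lambda>B. real (card B) / real (card A)) ` Pow A"
    using assms by (auto simp: measure_pmf_of_set)
  show "finite ((\<lambda>B. real (card B) / real (card A)) ` Pow A)"
    using assms by simp
qed

lemma finite_range_cheating_prob:
  "finite (range (cheating_prob m :: 'a::{finite,field} strategy \<Rightarrow> real))"
  by (rule finite_subset[OF _ finite_range_prob_pmf_of_set[of "UNIV \<times> ({1..m - 1} \<rightarrow>\<^sub>E UNIV)"]])
     (auto simp: cheating_prob_def PiE_eq_empty_iff intro!: finite_cartesian_product finite_PiE)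

lemma finite_CHSH_win_probs:
  "finite {CHSH_win_prob s1 s2 | s1 s2 :: 'a::{finite,field} \<Rightarrow> 'a. True}"
  by (rule finite_subset[OF _ finite_range_prob_pmf_of_set[of UNIV]])
     (auto simp: CHSH_win_prob_def)

lemma cheating_prob_le_optimal:
  fixes S :: "'a::{finite,field} strategy"
  shows "cheating_prob m S \<le> optimal_cheating_prob TYPE('a) m"
  unfolding optimal_cheating_prob_def by (rule Max_ge[OF finite_range_cheating_prob]) simp

end

theory Submission imports Defs begin

text \<open>
  Fix an optimal pair \<open>s1, s2\<close> for CHSH. Alice processes Bob's messages in blocks of three,
  keeping \<open>\<alpha>\<close> equal to \<open>0\<close> once it has vanished. If \<open>A\<close> is the value of \<open>\<alpha>\<close> before a block with
  messages \<open>u, v, w\<close>, the agents answer \<open>0\<close>, then \<open>- A * s2 v\<close>, then \<open>w * A * s1 u\<close>, which turns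
  \<open>\<alpha>\<close> into \<open>w * A * (s1 u + s2 v - u * v)\<close>. So a block fails to kill \<open>\<alpha>\<close> only if \<open>w \<noteq> 0\<close> and the
  CHSH game on \<open>(u, v)\<close> is lost. For \<open>d = 0\<close> Alice always succeeds; for \<open>d = 1\<close> she fails only
  if all \<open>(m - 1) div 3\<close> blocks fail, and these events are independent.
\<close>

text \<open>This is written on lists because an agent sees Bob's messages as a list. Rounding down
  in \<open>length xs div 3\<close> drops the messages of an unfinished block, so the second and
  third agents of a block compute the same value.\<close>

definition chsh_state :: "('a::field \<Rightarrow> 'a) \<Rightarrow> ('a \<Rightarrow> 'a) \<Rightarrow> bool \<Rightarrow> 'a list \<Rightarrow> 'a" where
  "chsh_state s1 s2 d xs = of_bool d * (\<Prod>j<length xs div 3.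
     xs ! (3*j+2) * (s1 (xs ! (3*j)) + s2 (xs ! (3*j+1)) - xs ! (3*j) * xs ! (3*j+1)))"

text \<open>In the third round of a block the agent holds the messages up to round
  \<open>i - 2\<close>, so \<open>last xs\<close> is the block's first message u, while the hidden
  message of round \<open>i - 1\<close> is v. The final answer 0 bets that \<alpha> has been
  killed.\<close>

definition chsh_strategy :: "('a::field \<Rightarrow> 'a) \<Rightarrow> ('a \<Rightarrow> 'a) \<Rightarrow> 'a strategy" where
  "chsh_strategy s1 s2 = \<lparr>
     first_answer = (\<lambda>_. 0),
     mid_answer = (\<lambda>i d xs x.
       if i mod 3 = 2 then - chsh_state s1 s2 d xs * s2 x
       else if i mod 3 = 0 then x * chsh_state s1 s2 d xs * s1 (last xs)
       else 0),
     last_answer = (\<lambda>_ _. 0)\<rparr>"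

text \<open>The counterpart of \<open>chsh_state\<close> on the message function, where indices
  start at 1 instead of 0.\<close>

definition chsh_blocks :: "('a::field \<Rightarrow> 'a) \<Rightarrow> ('a \<Rightarrow> 'a) \<Rightarrow> bool \<Rightarrow> (nat \<Rightarrow> 'a) \<Rightarrow> nat \<Rightarrow> 'a" where
  "chsh_blocks s1 s2 d x k = of_bool d * (\<Prod>j<k.
     x (3*j+3) * (s1 (x (3*j+1)) + s2 (x (3*j+2)) - x (3*j+1) * x (3*j+2)))"

text \<open>The remainder \<open>r\<close> counts the visible messages of the current block: 0 for
  its second agent, 1 for its third.\<close>

lemma chsh_state_map:
  assumes "n = 3 * k + r" "r < 3"
  shows "chsh_state s1 s2 d (map x [1..<Suc n]) = chsh_blocks s1 s2 d x k"
proof -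
  have "n div 3 = k" using assms by simp
  moreover have "map x [1..<Suc n] ! (3*j) = x (3*j+1)"
      "map x [1..<Suc n] ! (3*j+1) = x (3*j+2)"
      "map x [1..<Suc n] ! (3*j+2) = x (3*j+3)" if "j < k" for j
    using that assms by (simp_all add: numeral_3_eq_3 del: upt_Suc)
  ultimately show ?thesis
    unfolding chsh_state_def chsh_blocks_def length_map length_upt diff_Suc_1 One_nat_def[symmetric]
    by (intro arg_cong2[where f="(*)"] prod.cong refl) (simp_all del: upt_Suc)
qed

lemma chsh_strategy_answer:
  assumes "i < m"
  shows "i = 3*k+1 \<Longrightarrow> answer m (chsh_strategy s1 s2) d x i = 0"
    and "i = 3*k+2 \<Longrightarrow> answer m (chsh_strategy s1 s2) d x i =
           - chsh_blocks s1 s2 d x k * s2 (x i)"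
    and "i = 3*k+3 \<Longrightarrow> answer m (chsh_strategy s1 s2) d x i =
           x i * chsh_blocks s1 s2 d x k * s1 (x (3*k+1))"
proof -
  show "answer m (chsh_strategy s1 s2) d x i = 0" if "i = 3*k+1"
  proof -
    have "i mod 3 = 1" using that by presburger
    thus ?thesis using assms by (simp add: answer_def chsh_strategy_def)
  qed
  show "answer m (chsh_strategy s1 s2) d x i = - chsh_blocks s1 s2 d x k * s2 (x i)"
    if "i = 3*k+2"
  proof -
    have "i mod 3 = 2" "i \<noteq> 1" "i - 1 = Suc (3*k)" using that by presburger+
    thus ?thesis using assms chsh_state_map[of "3*k" k 0 s1 s2 d x]
      by (simp add: answer_def chsh_strategy_def del: upt_Suc)
  qed
  show "answer m (chsh_strategy s1 s2) d x i = x i * chsh_blocks s1 s2 d x k * s1 (x (3*k+1))"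
    if "i = 3*k+3"
  proof -
    have "i mod 3 = 0" "i \<noteq> 1" "i - 1 = Suc (3*k+1)" using that by presburger+
    moreover have "last (map x [1..<Suc (3*k+1)]) = x (3*k+1)" by simp
    ultimately show ?thesis using assms chsh_state_map[of "3*k+1" k 1 s1 s2 d x]
      by (simp add: answer_def chsh_strategy_def del: upt_Suc)
  qed
qed

lemma alpha_chsh_strategy:
  assumes "3 * k < m"
  shows "\<alpha> d x (answer m (chsh_strategy s1 s2) d x) (3*k) = chsh_blocks s1 s2 d x k"
  using assms
proof (induction k)
  case 0
  show ?case by (simp add: chsh_blocks_def)
next
  case (Suc k)
  define y where "y = answer m (chsh_strategy s1 s2) d x"
  define A where "A = chsh_blocks s1 s2 d x k"
  have y: "y (3*k+1) = 0" "y (3*k+2) = - A * s2 (x (3*k+2))"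
      "y (3*k+3) = x (3*k+3) * A * s1 (x (3*k+1))"
    using Suc.prems unfolding y_def A_def
    by (intro chsh_strategy_answer; simp)+
  have IH: "\<alpha> d x y (3*k) = A" using Suc unfolding y_def A_def by simp
  have "3 * Suc k = Suc (Suc (Suc (3*k)))" "3*k+1 = Suc (3*k)" "3*k+2 = Suc (Suc (3*k))"
      "3*k+3 = Suc (Suc (Suc (3*k)))" by simp_all
  \<comment> \<open>Unfolding stops after three rounds, so that the induction hypothesis applies to
    the innermost \<alpha>.\<close>
  hence "\<alpha> d x y (3 * Suc k) = y (3*k+3) - x (3*k+3) *
      (y (3*k+2) - x (3*k+2) * (y (3*k+1) - x (3*k+1) * \<alpha> d x y (3*k)))"
    by (simp only: \<alpha>.simps)
  also have "\<dots> = A * (x (3*k+3) * (s1 (x (3*k+1)) + s2 (x (3*k+2)) - x (3*k+1) * x (3*k+2)))"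
    unfolding y IH by (simp add: algebra_simps)
  also have "\<dots> = chsh_blocks s1 s2 d x (Suc k)"
    by (simp add: A_def chsh_blocks_def)
  finally show ?case unfolding y_def .
qed

text \<open>After the last full block at most two rounds precede round \<open>m\<close>. Their
  answers are 0, the second one because it is a multiple of the vanished state, so the recursion
  keeps \<alpha> at 0, which is also the final answer.\<close>

lemma success_chsh_strategy:
  assumes "m \<ge> 3" and "chsh_blocks s1 s2 d x ((m - 1) div 3) = 0"
  shows "success m (chsh_strategy s1 s2) d x"
proof -
  define k where "k = (m - 1) div 3"
  define y where "y = answer m (chsh_strategy s1 s2) d x"
  have m: "m = 3*k + 1 \<or> m = 3*k + 2 \<or> m = 3*k + 3"
    using assms(1) unfolding k_def by presburger
  have B: "chsh_blocks s1 s2 d x k = 0" using assms(2) unfolding k_def .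
  have z: "\<alpha> d x y (3*k) = 0"
    using alpha_chsh_strategy[of k m d x s1 s2] m B unfolding y_def by fastforce
  have y1: "y (3*k+1) = 0" if "m > 3*k+1"
    using chsh_strategy_answer(1)[OF that refl] unfolding y_def by simp
  have y2: "y (3*k+2) = 0" if "m > 3*k+2"
    using chsh_strategy_answer(2)[OF that refl, of s1 s2 d x] B unfolding y_def by simp
  have "\<alpha> d x y (m - 1) = 0"
    using m z y1 y2 by auto
  moreover have "y m = 0"
    using assms(1) by (simp add: y_def answer_def chsh_strategy_def)
  ultimately show ?thesis unfolding success_def y_def by simp
qed

text \<open>This is the independence of the blocks in counting form: cutting a message function into
  \<open>k\<close> triples and a tail is injective, and injectivity suffices for an upper
  bound.\<close>

lemma card_PiE_blocks_le:
  fixes P :: "'a::finite \<Rightarrow> 'a \<Rightarrow> 'a \<Rightarrow> bool"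
  assumes "3 * k \<le> n"
  shows "card {x \<in> {1..n} \<rightarrow>\<^sub>E UNIV. \<forall>j<k. P (x (3*j+1)) (x (3*j+2)) (x (3*j+3))}
     \<le> card {(u, v, w). P u v w} ^ k * CARD('a) ^ (n - 3*k)" (is "card ?X \<le> _")
proof -
  let ?f = "\<lambda>x::nat \<Rightarrow> 'a. (\<lambda>j\<in>{..<k}. (x (3*j+1), x (3*j+2), x (3*j+3)), restrict x {3*k+1..n})"
  let ?Y = "({..<k} \<rightarrow>\<^sub>E {(u, v, w). P u v w}) \<times> ({3*k+1..n} \<rightarrow>\<^sub>E (UNIV :: 'a set))"
  have "inj_on ?f ?X"
  proof (rule inj_onI)
    fix x y assume xy: "x \<in> ?X" "y \<in> ?X" and eq: "?f x = ?f y"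
    show "x = y"
    proof
      fix i
      \<comment> \<open>Outside the domain both functions are \<open>undefined\<close> by
        extensionality; the tail component settles the second case, and the triple with index
        \<open>(i-1) div 3\<close> the third.\<close>
      consider "i \<notin> {1..n}" | "i \<in> {3*k+1..n}"
        | j where "j < k" "i = 3*j+1 \<or> i = 3*j+2 \<or> i = 3*j+3"
      proof -
        have "i = 3*((i-1) div 3)+1 \<or> i = 3*((i-1) div 3)+2 \<or> i = 3*((i-1) div 3)+3"
            "(i-1) div 3 < k"
          if "1 \<le> i" "i \<le> 3*k" using that by presburger+
        moreover have "i \<notin> {1..n} \<or> i \<in> {3*k+1..n} \<or> 1 \<le> i \<and> i \<le> 3*k" by auto
        ultimately show ?thesis using that by blast
      qed
      thus "x i = y i"
      proof cases
        case 1
        thus ?thesis using xy by (auto simp: PiE_def extensional_def)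
      next
        case 2
        thus ?thesis using fun_cong[OF conjunct2[OF eq[unfolded prod.inject]], of i] by simp
      next
        case (3 j)
        thus ?thesis using fun_cong[OF conjunct1[OF eq[unfolded prod.inject]], of j] by auto
      qed
    qed
  qed
  moreover have "?f ` ?X \<subseteq> ?Y"
    by (rule image_subsetI) (simp add: restrict_PiE_iff)
  moreover have "finite ?Y" by (intro finite_cartesian_product finite_PiE) auto
  ultimately have "card ?X \<le> card ?Y" by (rule card_inj_on_le)
  also have "card ?Y = card {(u, v, w). P u v w} ^ k * CARD('a) ^ (n - 3*k)"
    by (simp add: card_cartesian_product card_PiE)
  finally show ?thesis .
qed

text \<open>The condition on w is separate from the one on (u, v), so the count is a product.
  Scaling by the cube of the field size makes each bad block contribute exactly its
  probability.\<close>

lemma card_losing_blocks: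
  fixes s1 s2 :: "'a::{finite,field} \<Rightarrow> 'a"
  shows "real (card {(u, v, w :: 'a). w \<noteq> 0 \<and> s1 u + s2 v \<noteq> u * v}) =
     ((1 - 1 / CARD('a)) * (1 - CHSH_win_prob s1 s2)) * real CARD('a) ^ 3"
proof -
  let ?W = "{(x, y). s1 x + s2 y = x * y}"
  let ?q = "real CARD('a)"
  have q: "?q > 0" by (simp add: zero_less_card_finite)
  have "{(u, v, w :: 'a). w \<noteq> 0 \<and> s1 u + s2 v \<noteq> u * v} = (\<lambda>((u, v), w). (u, v, w)) ` ((- ?W) \<times> (- {0}))"
    by force
  also have "card \<dots> = card ((- ?W) \<times> (- {0::'a}))"
    by (intro card_image) (auto simp: inj_on_def)
  finally have c: "real (card {(u, v, w :: 'a). w \<noteq> 0 \<and> s1 u + s2 v \<noteq> u * v}) =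
      real (card (- ?W)) * real (card (- {0::'a}))"
    by (simp add: card_cartesian_product)
  have "card ?W + card (- ?W) = CARD('a \<times> 'a)"
    by (subst card_Un_disjoint[symmetric]) (auto simp: Compl_partition)
  hence "real (card (- ?W)) = ?q\<^sup>2 - real (card ?W)"
    by (simp add: power2_eq_square flip: of_nat_add of_nat_mult add: eq_diff_eq add.commute)
  moreover have "CHSH_win_prob s1 s2 = real (card ?W) / ?q\<^sup>2"
    by (simp add: CHSH_win_prob_def measure_pmf_of_set power2_eq_square)
  ultimately have W: "1 - CHSH_win_prob s1 s2 = real (card (- ?W)) / ?q\<^sup>2"
    using q by (simp add: diff_divide_distrib)
  have "real (card (- {0::'a})) = ?q - 1"
    using q by (simp add: Compl_eq_Diff_UNIV card_Diff_subset of_nat_diff Suc_leI)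
  hence "1 - 1 / ?q = real (card (- {0::'a})) / ?q"
    using q by (simp add: diff_divide_distrib)
  thus ?thesis unfolding c W using q
    by (simp add: power2_eq_square power3_eq_cube)
qed

lemma cheating_prob_chsh_strategy:
  fixes s1 s2 :: "'a::{finite,field} \<Rightarrow> 'a"
  assumes "m \<ge> 3"
  shows "cheating_prob m (chsh_strategy s1 s2) \<ge>
     1 - 1 / 2 * ((1 - 1 / CARD('a)) * (1 - CHSH_win_prob s1 s2)) ^ ((m - 1) div 3)"
proof -
  define k where "k = (m - 1) div 3"
  define p where "p = (1 - 1 / real CARD('a)) * (1 - CHSH_win_prob s1 s2)"
  let ?q = "real CARD('a)"
  let ?E = "{1..m - 1} \<rightarrow>\<^sub>E (UNIV :: 'a set)"
  let ?A = "(UNIV :: bool set) \<times> ?E"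
  let ?S = "{(d, x). success m (chsh_strategy s1 s2) d x}"
  let ?P = "\<lambda>u v (w :: 'a). w \<noteq> 0 \<and> s1 u + s2 v \<noteq> u * v"
  let ?F = "{x \<in> ?E. \<forall>j<k. ?P (x (3*j+1)) (x (3*j+2)) (x (3*j+3))}"
  have q: "?q > 0" by (simp add: zero_less_card_finite)
  have k: "3 * k \<le> m - 1" unfolding k_def by simp
  have finE: "finite ?E" by (intro finite_PiE) auto
  have A: "finite ?A" "?A \<noteq> {}"
    using finE by (auto simp: PiE_eq_empty_iff)
  have cA: "real (card ?A) = 2 * ?q ^ (m - 1)"
    by (simp add: card_cartesian_product card_PiE)
  have "?A \<inter> - ?S \<subseteq> {True} \<times> ?F"
  proof
    fix z assume z: "z \<in> ?A \<inter> - ?S"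
    obtain d x where dx: "z = (d, x)" by force
    have "chsh_blocks s1 s2 d x k \<noteq> 0"
      using z success_chsh_strategy[OF assms] unfolding dx k_def by auto
    \<comment> \<open>A nonzero product has no zero factor: every block is bad, and
      \<open>of_bool d\<close> forces \<open>d\<close> to be true, whence the factor 1/2 in the
      bound.\<close>
    thus "z \<in> {True} \<times> ?F"
      using z unfolding dx chsh_blocks_def by auto
  qed
  hence "card (?A \<inter> - ?S) \<le> card ({True} \<times> ?F)"
    using finE by (intro card_mono) auto
  also have "\<dots> \<le> card {(u, v, w). ?P u v w} ^ k * CARD('a) ^ (m - 1 - 3*k)"
    using card_PiE_blocks_le[OF k, of ?P] by (simp add: card_cartesian_product)
  finally have "real (card (?A \<inter> - ?S)) \<le>
      real (card {(u, v, w). ?P u v w} ^ k * CARD('a) ^ (m - 1 - 3*k))"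
    by (rule of_nat_mono)
  also have "\<dots> = real (card {(u, v, w). ?P u v w}) ^ k * ?q ^ (m - 1 - 3*k)"
    by (simp only: of_nat_mult of_nat_power)
  also have "\<dots> = p ^ k * (?q ^ (3 * k) * ?q ^ (m - 1 - 3*k))"
    unfolding card_losing_blocks p_def by (simp add: power_mult_distrib power_mult)
  \<comment> \<open>The tail messages are unconstrained, so their count cancels against the
    total.\<close>
  also have "?q ^ (3 * k) * ?q ^ (m - 1 - 3*k) = ?q ^ (m - 1)"
    using k by (simp only: power_add[symmetric] le_add_diff_inverse)
  finally have "real (card (?A \<inter> - ?S)) / real (card ?A) \<le> 1 / 2 * p ^ k"
    unfolding cA using q by (simp add: field_simps)
  moreover have "measure_pmf.prob (pmf_of_set ?A) (- ?S) = real (card (?A \<inter> - ?S)) / real (card ?A)"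
    using A by (intro measure_pmf_of_set)
  moreover have "measure_pmf.prob (pmf_of_set ?A) (- ?S) = 1 - cheating_prob m (chsh_strategy s1 s2)"
    unfolding cheating_prob_def
    using measure_pmf.prob_compl[of ?S "pmf_of_set ?A"] by (simp add: Compl_eq_Diff_UNIV)
  ultimately show ?thesis unfolding k_def p_def by linarith
qed

lemma CHSH_value_attained:
  obtains s1 s2 :: "'a::{finite,field} \<Rightarrow> 'a" where "CHSH_win_prob s1 s2 = CHSH_value TYPE('a)"
proof -
  have "CHSH_value TYPE('a) \<in> {CHSH_win_prob s1 s2 | s1 s2 :: 'a \<Rightarrow> 'a. True}"
    unfolding CHSH_value_def by (rule Max_in[OF finite_CHSH_win_probs]) auto
  thus ?thesis using that by force
qed

theorem theorem2:
  fixes Q m :: nat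
  assumes "CARD('a::{finite,field}) = Q" and "m \<ge> 3"
  defines "bound \<equiv> 1 - 1 / 2 * ((1 - 1 / real Q) * (1 - CHSH_value TYPE('a))) ^ ((m - 1) div 3)"
  shows "(\<exists>S :: 'a strategy. cheating_prob m S \<ge> bound) \<and>
         optimal_cheating_prob TYPE('a) m \<ge> bound"
proof -
  obtain s1 s2 :: "'a \<Rightarrow> 'a" where "CHSH_win_prob s1 s2 = CHSH_value TYPE('a)"
    by (rule CHSH_value_attained)
  hence "cheating_prob m (chsh_strategy s1 s2) \<ge> bound"
    using cheating_prob_chsh_strategy[OF assms(2), of s1 s2] assms(1) unfolding bound_def by simp
  thus ?thesis
    using cheating_prob_le_optimal order_trans by blast
qed

end
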